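(* Let $N\ge n\ge 1$ and let $\tilde A$ be an $N\times N$ real symmetric extension of the $n\times n$ matrix $A$ (i.e. $\tilde A$ is symmetric and its top left $n\times n$ block is $A$). Then the smallest eigenvalue of $\tilde A$ is less than or equal to the smallest eigenvalue of $A$, and the largest eigenvalue of $\tilde A$ is greater than or equal to the largest eigenvalue of $A$. *)

theory Defs
  imports "Jordan_Normal_Form.Spectral_Radius"
begin

text \<open>
  For a type of scalars \<^typ>\<open>real\<close>, \<^term>\<open>spectrum A\<close> is the set of real eigenvalues of \<open>A\<close>.
  For a symmetric matrix of positive size this set is finite and nonempty, so that
  \<open>Min (spectrum A)\<close> and \<open>Max (spectrum A)\<close> are its smallest and its largest eigenvalue.
\<close>

lemma real_symmetric_spectrum_finite_nonempty:
  fixes A :: "real mat"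
  assumes A: "A \<in> carrier_mat n n" and n: "n \<ge> 1" and sym: "transpose_mat A = A"
  shows "finite (spectrum A)" and "spectrum A \<noteq> {}"
proof -
  show "finite (spectrum A)" using card_finite_spectrum[OF A] by simp
  define C where "C = map_mat complex_of_real A"
  have C: "C \<in> carrier_mat n n" using A by (simp add: C_def)
  obtain k where "k \<in> spectrum C" using spectrum_non_empty[OF C] n by auto
  then have k: "eigenvalue C k" by (simp add: spectrum_def)
  then obtain v where v: "v \<in> carrier_vec n" "v \<noteq> 0\<^sub>v n" "C *\<^sub>v v = k \<cdot>\<^sub>v v"
    using C by (auto simp: eigenvalue_def eigenvector_def)
  have entry: "C $$ (i,j) = cnj (C $$ (j,i))" if "i < n" "j < n" for i j
  proof -
    have "A $$ (i,j) = transpose_mat A $$ (i,j)" by (simp add: sym)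
    then show ?thesis using that A by (simp add: C_def)
  qed
  have mv: "(\<Sum>j<n. C $$ (i,j) * v $ j) = k * v $ i" if "i < n" for i
  proof -
    have "(C *\<^sub>v v) $ i = (\<Sum>j<n. C $$ (i,j) * v $ j)"
      using that C v(1) by (auto simp: scalar_prod_def atLeast0LessThan intro!: sum.cong)
    then show ?thesis using v that by simp
  qed
  define s where "s = (\<Sum>i<n. v $ i * cnj (v $ i))"
  have "k * s = (\<Sum>i<n. \<Sum>j<n. C $$ (i,j) * v $ j * cnj (v $ i))"
    unfolding s_def sum_distrib_left
    by (intro sum.cong refl) (simp add: mv[symmetric] sum_distrib_right mult.assoc[symmetric])
  also have "\<dots> = (\<Sum>j<n. \<Sum>i<n. C $$ (i,j) * v $ j * cnj (v $ i))"
    by (rule sum.swap)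
  also have "\<dots> = (\<Sum>j<n. v $ j * cnj (\<Sum>i<n. C $$ (j,i) * v $ i))"
  proof (intro sum.cong refl)
    fix j assume j: "j \<in> {..<n}"
    have "C $$ (i,j) * v $ j * cnj (v $ i) = v $ j * cnj (C $$ (j,i) * v $ i)"
      if "i \<in> {..<n}" for i
      using that j by (simp only: entry[of i j] lessThan_iff complex_cnj_mult mult_ac)
    then show "(\<Sum>i<n. C $$ (i,j) * v $ j * cnj (v $ i))
        = v $ j * cnj (\<Sum>i<n. C $$ (j,i) * v $ i)"
      by (simp only: cnj_sum sum_distrib_left cong: sum.cong)
  qed
  also have "\<dots> = cnj k * s"
    unfolding s_def sum_distrib_left by (intro sum.cong refl) (simp del: cnj_sum add: mv)
  finally have ks: "k * s = cnj k * s" .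
  have "s = complex_of_real (\<Sum>i<n. (cmod (v $ i))\<^sup>2)"
    by (simp only: s_def of_real_sum complex_norm_square)
  moreover obtain i where "i < n" "v $ i \<noteq> 0" using v by (auto simp: vec_eq_iff)
  then have "(\<Sum>i<n. (cmod (v $ i))\<^sup>2) > 0" by (intro sum_pos2[of _ i]) auto
  ultimately have "s \<noteq> 0" by (metis less_irrefl of_real_eq_0_iff)
  then have "cnj k = k" using ks by simp
  then have kr: "k = complex_of_real (Re k)" by (simp add: complex_eq_iff)
  have "poly (char_poly C) k = 0" using k eigenvalue_root_char_poly[OF C] by simp
  moreover have "char_poly C = map_poly complex_of_real (char_poly A)"
    unfolding C_def by (rule of_real_hom.char_poly_hom[OF A])
  ultimately have "poly (map_poly complex_of_real (char_poly A)) (complex_of_real (Re k)) = 0"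
    by (simp only: kr[symmetric])
  then have "poly (char_poly A) (Re k) = 0" by simp
  then have "eigenvalue A (Re k)" using eigenvalue_root_char_poly[OF A] by simp
  then show "spectrum A \<noteq> {}" by (auto simp: spectrum_def)
qed

end

theory Submission
  imports Defs "HOL-Analysis.Function_Topology"
begin

text \<open>
  The quadratic form of a symmetric matrix attains its maximum on the unit sphere, and a
  maximiser is an eigenvector, so the form is bounded by an eigenvalue times the squared norm.
  Padding an eigenvector of \<open>A\<close> with zeros gives a vector on which the form of \<open>A'\<close> is the
  eigenvalue times the squared norm. The smallest eigenvalue is treated by negating the matrix.
\<close>

text \<open>Vectors are encoded as functions on all naturals that vanish from \<open>n\<close> on.
  The sphere is then a closed subset of a product of compact sets, so Tychonoff applies; fixing the
  tail to 0 is what keeps the set compact.\<close>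

lemma compact_unit_sphere_fun:
  fixes n :: nat
  shows "compact {x :: nat \<Rightarrow> real. (\<forall>i\<ge>n. x i = 0) \<and> (\<Sum>i<n. (x i)\<^sup>2) = 1}"
    (is "compact ?K")
proof -
  \<comment> \<open>Each factor is compact: an interval below \<open>n\<close>, a singleton from
    \<open>n\<close> on.\<close>
  define B where "B = PiE UNIV (\<lambda>i. if i < n then {-1..1} else {0 :: real})"
  have "compactin (product_topology (\<lambda>i::nat. euclidean :: real topology) UNIV) B"
    unfolding B_def compactin_PiE by simp
  then have "compact B" by (simp add: euclidean_product_topology)
  moreover have "closed {x :: nat \<Rightarrow> real. (\<Sum>i<n. (x i)\<^sup>2) = 1}"
    by (intro closed_Collect_eq continuous_intros continuous_on_product_coordinates)
  ultimately have "compact (B \<inter> {x. (\<Sum>i<n. (x i)\<^sup>2) = 1})" by (rule compact_Int_closed)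
  moreover have "?K = B \<inter> {x. (\<Sum>i<n. (x i)\<^sup>2) = 1}"
  proof -
    have "\<bar>x i\<bar> \<le> 1" if "(\<Sum>i<n. (x i)\<^sup>2) = 1" "i < n" for x :: "nat \<Rightarrow> real" and i
    proof -
      have "(x i)\<^sup>2 \<le> (\<Sum>i<n. (x i)\<^sup>2)" using that(2) by (intro member_le_sum) auto
      then show ?thesis using that(1) by (simp add: abs_square_le_1)
    qed
    then have "x \<in> ?K \<longleftrightarrow> x \<in> B" if "(\<Sum>i<n. (x i)\<^sup>2) = 1" for x
      using that by (auto simp: B_def PiE_iff abs_le_iff not_le minus_le_iff)
    then show ?thesis by blast
  qed
  ultimately show ?thesis by simp
qed

text \<open>First-order condition at a maximum, without derivatives: for small \<open>t\<close> the
  linear term dominates, so a nonzero \<open>b\<close> would give a positive value for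
  \<open>t\<close> of the same sign as \<open>b\<close>.\<close>

lemma linear_coeff_zero_if_quadratic_nonpos:
  fixes b c :: real
  assumes "\<And>t. t * b + t\<^sup>2 * c \<le> 0"
  shows "b = 0"
proof (rule ccontr)
  assume "b \<noteq> 0"
  \<comment> \<open>This scale makes \<open>s * c\<close> smaller than 1 in absolute value, so the
    quadratic is positive at \<open>t = s * b\<close>.\<close>
  define s where "s = 1 / (1 + \<bar>c\<bar>)"
  have s: "s > 0" "s * \<bar>c\<bar> < 1" by (auto simp: s_def field_simps)
  have "s * b * b + (s * b)\<^sup>2 * c = s * b\<^sup>2 * (1 + s * c)"
    by (simp add: power2_eq_square algebra_simps)
  moreover have "1 + s * c > 0"
    using s abs_le_D2[of "s * c" "s * \<bar>c\<bar>"] by (simp add: abs_mult)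
  then have "s * b\<^sup>2 * (1 + s * c) > 0" using s \<open>b \<noteq> 0\<close> by simp
  ultimately show False using assms[of "s * b"] by simp
qed

text \<open>Take \<open>x\<close> maximising the form \<open>Q\<close> on the unit sphere and
  \<open>m = Q x\<close>. By homogeneity \<open>Q - m * S\<close> is nonpositive everywhere, and it
  vanishes at \<open>x\<close>, so its first variation at \<open>x\<close> is zero in every
  coordinate direction; this is the eigenvalue equation. Stating it for entries \<open>a i j\<close>
  allows it to be applied to negated entries as well.\<close>

lemma symmetric_form_bounded_by_eigenvalue:
  fixes a :: "nat \<Rightarrow> nat \<Rightarrow> real"
  assumes n: "1 \<le> n" and sym: "\<forall>i<n. \<forall>j<n. a i j = a j i"
  shows "\<exists>m x. (\<exists>i<n. x i \<noteq> 0) \<and> (\<forall>i<n. (\<Sum>j<n. a i j * x j) = m * x i) \<and>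
    (\<forall>y. (\<Sum>i<n. \<Sum>j<n. a i j * y i * y j) \<le> m * (\<Sum>i<n. (y i)\<^sup>2))"
proof -
  define Q where "Q y = (\<Sum>i<n. \<Sum>j<n. a i j * y i * y j)" for y
  define S where "S y = (\<Sum>i<n. (y i)\<^sup>2)" for y :: "nat \<Rightarrow> real"
  define K where "K = {x. (\<forall>i\<ge>n. x i = 0) \<and> S x = 1}"
  have "compact K" unfolding K_def S_def by (rule compact_unit_sphere_fun)
  \<comment> \<open>The first unit vector shows that the sphere is nonempty; this needs
    \<open>n\<close> to be positive.\<close>
  moreover have "(\<lambda>i. if i = 0 then 1 else 0) \<in> K"
    using n by (simp add: K_def S_def if_distrib[of "\<lambda>z. z\<^sup>2"] sum.delta cong: if_cong)
  moreover have "continuous_on K Q"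
    unfolding Q_def
    by (intro continuous_intros continuous_on_subset[OF continuous_on_product_coordinates]) auto
  ultimately obtain x where x: "x \<in> K" and xmax: "\<And>y. y \<in> K \<Longrightarrow> Q y \<le> Q x"
    using continuous_attains_sup[of K Q] by blast
  have S1: "S x = 1" using x by (simp add: K_def)
  have bound: "Q y \<le> Q x * S y" for y
  proof (cases "S y = 0")
    case True
    then have "y i = 0" if "i < n" for i
      using that by (simp add: S_def sum_nonneg_eq_0_iff)
    then show ?thesis using True by (simp add: Q_def)
  next
    case False
    then have pos: "S y > 0" by (simp add: S_def order.strict_iff_order sum_nonneg)
    define r where "r = 1 / sqrt (S y)"
    have r2: "r\<^sup>2 = 1 / S y" using pos by (simp add: r_def power_divide)
    \<comment> \<open>Besides normalising, \<open>z\<close> cuts \<open>y\<close> off at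
      \<open>n\<close>, since \<open>y\<close> is arbitrary there; \<open>Q\<close> and
      \<open>S\<close> do not see the tail.\<close>
    define z where "z i = (if i < n then r * y i else 0)" for i
    have "S z = r\<^sup>2 * S y"
      by (simp add: S_def z_def sum_distrib_left power_mult_distrib)
    then have "z \<in> K" using pos by (simp add: K_def z_def r2)
    moreover have "Q z = r\<^sup>2 * Q y"
      by (simp add: Q_def z_def sum_distrib_left power2_eq_square mult_ac)
    ultimately have "Q y / S y \<le> Q x" using xmax[of z] by (simp add: r2)
    then show ?thesis using pos by (simp add: pos_divide_le_eq)
  qed
  have eigen: "(\<Sum>j<n. a i j * x j) = Q x * x i" if i: "i < n" for i
  proof -
    \<comment> \<open>The \<open>i\<close>-th unit vector, the direction in which \<open>x\<close>
      is perturbed.\<close>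
    define e where "e j = (if j = i then 1 else 0 :: real)" for j
    define g where "g = (\<Sum>j<n. a i j * x j)"
    have Qt: "Q (\<lambda>j. x j + t * e j) = Q x + 2 * t * g + t\<^sup>2 * a i i" for t
    proof -
      have "Q (\<lambda>j. x j + t * e j) = Q x + t * (\<Sum>k<n. \<Sum>j<n. a k j * x k * e j)
        + t * (\<Sum>k<n. \<Sum>j<n. a k j * e k * x j) + t\<^sup>2 * (\<Sum>k<n. \<Sum>j<n. a k j * e k * e j)"
        unfolding Q_def sum_distrib_left sum.distrib[symmetric]
        by (intro sum.cong refl) (simp add: power2_eq_square algebra_simps)
      moreover have "(\<Sum>k<n. \<Sum>j<n. a k j * x k * e j) = (\<Sum>k<n. a k i * x k)"
        using i by (simp add: e_def if_distrib[of "\<lambda>z. _ * z"] cong: if_cong)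
      \<comment> \<open>Symmetry makes the two cross terms equal, which gives the term
        \<open>2 * t * g\<close>.\<close>
      moreover have "\<dots> = g"
        unfolding g_def using i sym by (intro sum.cong) auto
      moreover have "(\<Sum>k<n. \<Sum>j<n. a k j * e k * x j) = (\<Sum>j<n. \<Sum>k<n. a k j * e k * x j)"
        by (rule sum.swap)
      moreover have "\<dots> = g"
        using i by (simp add: g_def e_def if_distrib[of "\<lambda>z. _ * z"] if_distrib[of "\<lambda>z. z * _"]
            cong: if_cong)
      moreover have "(\<Sum>k<n. \<Sum>j<n. a k j * e k * e j) = a i i"
        using i by (simp add: e_def if_distrib[of "\<lambda>z. _ * z"] cong: if_cong)
      ultimately show ?thesis by simp
    qed
    have St: "S (\<lambda>j. x j + t * e j) = 1 + 2 * t * x i + t\<^sup>2" for t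
    proof -
      have "S (\<lambda>j. x j + t * e j) = S x + 2 * t * (\<Sum>j<n. x j * e j) + t\<^sup>2 * (\<Sum>j<n. e j * e j)"
        unfolding S_def sum_distrib_left sum.distrib[symmetric]
        by (intro sum.cong refl) (simp add: power2_eq_square algebra_simps)
      moreover have "(\<Sum>j<n. x j * e j) = x i" "(\<Sum>j<n. e j * e j) = 1"
        using i by (simp_all add: e_def if_distrib[of "\<lambda>z. _ * z"] cong: if_cong)
      ultimately show ?thesis by (simp add: S1)
    qed
    \<comment> \<open>The constant terms of \<open>bound\<close> cancel because
      \<open>S x = 1\<close>.\<close>
    have "t * (2 * (g - Q x * x i)) + t\<^sup>2 * (a i i - Q x) \<le> 0" for t
      using bound[of "\<lambda>j. x j + t * e j"] unfolding Qt St by (simp add: algebra_simps)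
    then have "2 * (g - Q x * x i) = 0" by (rule linear_coeff_zero_if_quadratic_nonpos)
    then show ?thesis by (simp add: g_def)
  qed
  have "\<exists>i<n. x i \<noteq> 0"
  proof (rule ccontr)
    assume "\<not> ?thesis"
    then have "S x = 0" by (simp add: S_def)
    then show False using S1 by simp
  qed
  then show ?thesis using eigen bound unfolding Q_def S_def by blast
qed

lemma mult_mat_vec_index_sum:
  assumes "A \<in> carrier_mat n n" "v \<in> carrier_vec n" "i < n"
  shows "vec_index (A *\<^sub>v v) i = (\<Sum>j<n. A $$ (i, j) * vec_index v j)"
  using assms by (auto simp: scalar_prod_def atLeast0LessThan intro!: sum.cong)

text \<open>Carries eigenvectors from index functions, as the variational argument yields them, to
  \<open>spectrum\<close>; values of \<open>x\<close> from \<open>n\<close> on are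
  irrelevant.\<close>

lemma spectrumI_fun:
  fixes A :: "real mat"
  assumes A: "A \<in> carrier_mat n n" and nz: "\<exists>i<n. x i \<noteq> 0"
    and eq: "\<And>i. i < n \<Longrightarrow> (\<Sum>j<n. A $$ (i, j) * x j) = k * x i"
  shows "k \<in> spectrum A"
proof -
  have "Matrix.vec n x \<noteq> 0\<^sub>v n"
    using nz by (metis index_vec index_zero_vec(1))
  moreover have "A *\<^sub>v Matrix.vec n x = k \<cdot>\<^sub>v Matrix.vec n x"
  proof (rule eq_vecI)
    fix i assume "i < dim_vec (k \<cdot>\<^sub>v Matrix.vec n x)"
    then have i: "i < n" by simp
    show "vec_index (A *\<^sub>v Matrix.vec n x) i = vec_index (k \<cdot>\<^sub>v Matrix.vec n x) i"
      using i eq[OF i] mult_mat_vec_index_sum[OF A _ i, of "Matrix.vec n x"] by simp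
  qed (use A in simp)
  ultimately have "eigenvector A (Matrix.vec n x) k"
    using A by (simp add: eigenvector_def)
  then show ?thesis by (auto simp: spectrum_def eigenvalue_def)
qed

lemma spectrumE_fun:
  fixes A :: "real mat"
  assumes A: "A \<in> carrier_mat n n" and k: "k \<in> spectrum A"
  obtains x where "\<exists>i<n. x i \<noteq> 0" "\<And>i. i < n \<Longrightarrow> (\<Sum>j<n. A $$ (i, j) * x j) = k * x i"
proof -
  obtain v where v: "v \<in> carrier_vec n" "v \<noteq> 0\<^sub>v n" "A *\<^sub>v v = k \<cdot>\<^sub>v v"
    using k A by (auto simp: spectrum_def eigenvalue_def eigenvector_def)
  have "\<exists>i<n. vec_index v i \<noteq> 0" using v(1,2) by (auto simp: Matrix.vec_eq_iff)
  moreover have "(\<Sum>j<n. A $$ (i, j) * vec_index v j) = k * vec_index v i" if "i < n" for i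
    using mult_mat_vec_index_sum[OF A v(1) that] v that by simp
  ultimately show ?thesis using that by blast
qed

lemma symmetric_mat_index:
  assumes "A \<in> carrier_mat n n" "transpose_mat A = A" "i < n" "j < n"
  shows "A $$ (i, j) = A $$ (j, i)"
  using assms index_transpose_mat(1)[of i A j] by simp

lemma symmetric_form_le_spectrum:
  fixes A :: "real mat"
  assumes n: "1 \<le> n" and A: "A \<in> carrier_mat n n" and sym: "transpose_mat A = A"
  shows "\<exists>m\<in>spectrum A.
    \<forall>y. (\<Sum>i<n. \<Sum>j<n. A $$ (i, j) * y i * y j) \<le> m * (\<Sum>i<n. (y i)\<^sup>2)"
proof -
  have "\<forall>i<n. \<forall>j<n. A $$ (i, j) = A $$ (j, i)"
    using symmetric_mat_index[OF A sym] by blast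
  from symmetric_form_bounded_by_eigenvalue[OF n this] show ?thesis
  proof (elim exE conjE)
    fix m x l
    assume l: "l < n" "x l \<noteq> 0" and eig: "\<forall>i<n. (\<Sum>j<n. A $$ (i, j) * x j) = m * x i"
      and le: "\<forall>y. (\<Sum>i<n. \<Sum>j<n. A $$ (i, j) * y i * y j) \<le> m * (\<Sum>i<n. (y i)\<^sup>2)"
    have "\<exists>i<n. x i \<noteq> 0" using l by blast
    then have "m \<in> spectrum A" using eig by (intro spectrumI_fun[OF A, of x]) simp_all
    then show ?thesis using le by (rule rev_bexI)
  qed
qed

text \<open>The upper bound is applied to the negated entries: an eigenvalue \<open>m\<close>
  bounding that form from above turns into the eigenvalue \<open>- m\<close> of \<open>A\<close>
  bounding its form from below.\<close>

lemma symmetric_form_ge_spectrum: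
  fixes A :: "real mat"
  assumes n: "1 \<le> n" and A: "A \<in> carrier_mat n n" and sym: "transpose_mat A = A"
  shows "\<exists>m\<in>spectrum A.
    \<forall>y. m * (\<Sum>i<n. (y i)\<^sup>2) \<le> (\<Sum>i<n. \<Sum>j<n. A $$ (i, j) * y i * y j)"
proof -
  have "\<forall>i<n. \<forall>j<n. - A $$ (i, j) = - A $$ (j, i)"
    using symmetric_mat_index[OF A sym] by simp
  from symmetric_form_bounded_by_eigenvalue[OF n this] show ?thesis
  proof (elim exE conjE)
    fix m x l
    assume l: "l < n" "x l \<noteq> 0" and eig: "\<forall>i<n. (\<Sum>j<n. - A $$ (i, j) * x j) = m * x i"
      and le: "\<forall>y. (\<Sum>i<n. \<Sum>j<n. - A $$ (i, j) * y i * y j) \<le> m * (\<Sum>i<n. (y i)\<^sup>2)"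
    have "- m \<in> spectrum A"
    proof (rule spectrumI_fun[OF A])
      show "\<exists>i<n. x i \<noteq> 0" using l by blast
      show "(\<Sum>j<n. A $$ (i, j) * x j) = - m * x i" if "i < n" for i
        using eig that by (simp add: sum_negf minus_equation_iff)
    qed
    moreover have "\<forall>y. - m * (\<Sum>i<n. (y i)\<^sup>2) \<le> (\<Sum>i<n. \<Sum>j<n. A $$ (i, j) * y i * y j)"
      using le by (simp add: sum_negf minus_le_iff)
    ultimately show ?thesis by (rule rev_bexI)
  qed
qed

theorem theorem6:
  fixes n N :: nat and A A' :: "real mat"
  assumes "1 \<le> n" and "n \<le> N"
    and "A \<in> carrier_mat n n"
    and "A' \<in> carrier_mat N N"
    and "transpose_mat A' = A'"
    and "\<And>i j. i < n \<Longrightarrow> j < n \<Longrightarrow> A' $$ (i, j) = A $$ (i, j)"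
  shows "Min (spectrum A') \<le> Min (spectrum A) \<and> Max (spectrum A') \<ge> Max (spectrum A)"
proof -
  have N: "1 \<le> N" using assms(1,2) by simp
  \<comment> \<open>\<open>A\<close> inherits symmetry as a leading block of \<open>A'\<close>; this
    makes its spectrum nonempty, so that \<open>Min\<close> and \<open>Max\<close> are
    attained.\<close>
  have sym: "transpose_mat A = A"
    using assms(2,3) symmetric_mat_index[OF assms(4,5)]
    by (intro eq_matI) (auto simp: assms(6)[symmetric])
  note fin = real_symmetric_spectrum_finite_nonempty[OF assms(3,1) sym]
  note fin' = real_symmetric_spectrum_finite_nonempty[OF assms(4) N assms(5)]
  \<comment> \<open>Stated for every eigenvalue \<open>k\<close>, as it serves both the largest and
    the smallest one. Positivity of the squared norm allows it to be cancelled later.\<close>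
  have padded: "\<exists>y. (\<Sum>i<N. (y i)\<^sup>2) > 0
      \<and> (\<Sum>i<N. \<Sum>j<N. A' $$ (i, j) * y i * y j) = k * (\<Sum>i<N. (y i)\<^sup>2)"
    if k: "k \<in> spectrum A" for k
  proof -
    obtain x where x: "\<exists>i<n. x i \<noteq> 0"
      and eig: "\<And>i. i < n \<Longrightarrow> (\<Sum>j<n. A $$ (i, j) * x j) = k * x i"
      using spectrumE_fun[OF assms(3) k] by blast
    define y where "y i = (if i < n then x i else 0)" for i
    have restrict: "(\<Sum>i<N. f i) = (\<Sum>i<n. f i)" if "\<And>i. n \<le> i \<Longrightarrow> f i = 0" for f :: "nat \<Rightarrow> real"
      using assms(2) that by (intro sum.mono_neutral_right) auto
    have S: "(\<Sum>i<N. (y i)\<^sup>2) = (\<Sum>i<n. (x i)\<^sup>2)"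
      by (subst restrict) (simp_all add: y_def)
    have "(\<Sum>i<N. \<Sum>j<N. A' $$ (i, j) * y i * y j) = (\<Sum>i<n. \<Sum>j<n. A' $$ (i, j) * y i * y j)"
      by (simp add: restrict y_def)
    also have "\<dots> = (\<Sum>i<n. x i * (\<Sum>j<n. A $$ (i, j) * x j))"
      by (simp add: y_def assms(6) sum_distrib_left mult_ac)
    also have "\<dots> = k * (\<Sum>i<n. (x i)\<^sup>2)"
      unfolding sum_distrib_left
      by (intro sum.cong refl) (simp add: eig power2_eq_square flip: sum_distrib_left)
    finally have Q: "(\<Sum>i<N. \<Sum>j<N. A' $$ (i, j) * y i * y j) = k * (\<Sum>i<N. (y i)\<^sup>2)"
      by (simp add: S)
    obtain i where "i < n" "x i \<noteq> 0" using x by blast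
    then have "(\<Sum>i<n. (x i)\<^sup>2) > 0" by (intro sum_pos2[of _ i]) auto
    then have "(\<Sum>i<N. (y i)\<^sup>2) > 0" by (simp add: S)
    with Q show ?thesis by blast
  qed
  have "Max (spectrum A) \<le> Max (spectrum A')"
  proof -
    \<comment> \<open>It is enough that \<open>m\<close> is some eigenvalue of \<open>A'\<close>
      bounding the form; it need not be identified with the maximum.\<close>
    obtain m where m: "m \<in> spectrum A'"
      and le: "\<forall>y. (\<Sum>i<N. \<Sum>j<N. A' $$ (i, j) * y i * y j) \<le> m * (\<Sum>i<N. (y i)\<^sup>2)"
      using symmetric_form_le_spectrum[OF N assms(4,5)] by (elim bexE)
    obtain y where "(\<Sum>i<N. (y i)\<^sup>2) > 0"
      "(\<Sum>i<N. \<Sum>j<N. A' $$ (i, j) * y i * y j) = Max (spectrum A) * (\<Sum>i<N. (y i)\<^sup>2)"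
      using padded[OF Max_in[OF fin]] by (elim exE conjE)
    then have "Max (spectrum A) \<le> m" using spec[OF le, of y] by simp
    also have "m \<le> Max (spectrum A')" using fin'(1) m by (rule Max_ge)
    finally show ?thesis .
  qed
  moreover have "Min (spectrum A') \<le> Min (spectrum A)"
  proof -
    obtain m where m: "m \<in> spectrum A'"
      and ge: "\<forall>y. m * (\<Sum>i<N. (y i)\<^sup>2) \<le> (\<Sum>i<N. \<Sum>j<N. A' $$ (i, j) * y i * y j)"
      using symmetric_form_ge_spectrum[OF N assms(4,5)] by (elim bexE)
    obtain y where "(\<Sum>i<N. (y i)\<^sup>2) > 0"
      "(\<Sum>i<N. \<Sum>j<N. A' $$ (i, j) * y i * y j) = Min (spectrum A) * (\<Sum>i<N. (y i)\<^sup>2)"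
      using padded[OF Min_in[OF fin]] by (elim exE conjE)
    \<comment> \<open>The lower bound at the padded eigenvector, divided by its positive squared
      norm.\<close>
    then have "m \<le> Min (spectrum A)" using spec[OF ge, of y] by simp
    moreover have "Min (spectrum A') \<le> m" using fin'(1) m by (rule Min_le)
    ultimately show ?thesis by simp
  qed
  ultimately show ?thesis by simp
qed

end
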